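(* Let $n$ be an integer with $n \geq 3$, and let $U_n(x, y)$ denote the homogenization $y^n U_n(x/y)$ of the Chebyshev polynomial of the second kind $U_n(x)$. Then $$A_{U_n} > \frac{8}{3} + \left(B\left(1 + \frac{1}{n}, \frac{1}{2}\right) - 2\right) + \frac{2}{3}\left((n + 1)^{-2/n} - 1\right)$$ and $$A_{U_n} < \frac{8}{3} + \left(B\left(1 + \frac{1}{n}, \frac{1}{2}\right) - 2\right) + B\left(\frac{1}{2} - \frac{1}{n}, \frac{1}{2}\right) - \pi.$$ Furthermore, $\lim_{n \to \infty} A_{U_n} = \frac{8}{3}$.
   Context: $U_n(x)$ is the Chebyshev polynomial of the second kind, $U_n(\cos\theta) = \frac{\sin((n+1)\theta)}{\sin\theta}$. For a binary form $F(x,y)$ with real coefficients, $A_F$ denotes the area of the set $\{(x, y) \in \mathbb R^2 : |F(x, y)| \leq 1\}$. $B(x,y) = \int_0^1 t^{x-1}(1-t)^{y-1}\,dt$ is the beta function. *)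

theory Defs
  imports "HOL-Analysis.Analysis" "HOL-Computational_Algebra.Polynomial"
begin

definition is_cheb_U :: "nat \<Rightarrow> real poly \<Rightarrow> bool" where
  "is_cheb_U n p \<longleftrightarrow>
     (\<forall>\<theta>. sin \<theta> \<noteq> 0 \<longrightarrow> poly p (cos \<theta>) = sin (real (n + 1) * \<theta>) / sin \<theta>)"

(* Well defined by cheb_U_ex1 below. *)
definition cheb_U :: "nat \<Rightarrow> real poly" where
  "cheb_U n = (THE p. is_cheb_U n p)"

lemma is_cheb_U_unique:
  assumes "is_cheb_U n p" "is_cheb_U n q"
  shows "p = q"
proof (rule ccontr)
  assume "p \<noteq> q"
  hence "finite {x. poly (p - q) x = 0}"
    by (intro poly_roots_finite) auto
  moreover have "{-1<..<1} \<subseteq> {x. poly (p - q) x = 0}"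
  proof
    fix x :: real assume "x \<in> {-1<..<1}"
    hence x: "-1 < x" "x < 1" by auto
    have "sin (arccos x) > 0"
      using arccos_lt_bounded[OF x] by (intro sin_gt_zero) auto
    moreover have "cos (arccos x) = x"
      using x by (intro cos_arccos) auto
    ultimately show "x \<in> {x. poly (p - q) x = 0}"
      using assms unfolding is_cheb_U_def by (metis (mono_tags, lifting) poly_diff
        right_minus_eq mem_Collect_eq less_irrefl)
  qed
  ultimately have "finite {-1<..<1::real}" by (rule rev_finite_subset)
  thus False by (simp add: infinite_Ioo)
qed

lemma is_cheb_U_0: "is_cheb_U 0 1"
  by (simp add: is_cheb_U_def)

lemma is_cheb_U_1: "is_cheb_U (Suc 0) [:0, 2:]"
  by (simp add: is_cheb_U_def sin_double)

lemma is_cheb_U_step: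
  assumes "is_cheb_U n p" "is_cheb_U (Suc n) q"
  shows "is_cheb_U (Suc (Suc n)) ([:0, 2:] * q - p)"
  unfolding is_cheb_U_def
proof (intro allI impI)
  fix \<theta> :: real assume s: "sin \<theta> \<noteq> 0"
  define a where "a = real (n + 2) * \<theta>"
  have e: "real (Suc (Suc n) + 1) * \<theta> = a + \<theta>" "real (n + 1) * \<theta> = a - \<theta>"
    "real (Suc n + 1) * \<theta> = a"
    by (simp_all add: a_def algebra_simps)
  have "sin (a + \<theta>) = 2 * cos \<theta> * sin a - sin (a - \<theta>)"
    by (simp add: sin_add sin_diff)
  moreover have "poly p (cos \<theta>) = sin (a - \<theta>) / sin \<theta>" "poly q (cos \<theta>) = sin a / sin \<theta>"
    using assms s unfolding is_cheb_U_def by (metis e(2), metis e(3))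
  ultimately show "poly ([:0, 2:] * q - p) (cos \<theta>) = sin (real (Suc (Suc n) + 1) * \<theta>) / sin \<theta>"
    unfolding e(1) by (simp add: diff_divide_distrib)
qed

lemma is_cheb_U_exists: "\<exists>p. is_cheb_U n p \<and> degree p \<le> n"
proof (induction n rule: induct_nat_012)
  case 0
  show ?case using is_cheb_U_0 by (intro exI[of _ 1]) simp
next
  case 1
  show ?case using is_cheb_U_1 by (intro exI[of _ "[:0, 2:]"]) simp
next
  case (ge2 n)
  then obtain p q where pq: "is_cheb_U n p" "degree p \<le> n" "is_cheb_U (Suc n) q" "degree q \<le> Suc n"
    by blast
  have "degree ([:0, 2:] * q) \<le> Suc (Suc n)"
    using degree_mult_le[of "[:0, 2:]" q] pq(4) by simp
  hence "degree ([:0, 2:] * q - p) \<le> Suc (Suc n)"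
    using pq(2) by (intro degree_diff_le) auto
  thus ?case using is_cheb_U_step[OF pq(1,3)] by blast
qed

lemma cheb_U_ex1: "\<exists>!p. is_cheb_U n p"
  using is_cheb_U_exists is_cheb_U_unique by blast

lemma is_cheb_U_cheb_U: "is_cheb_U n (cheb_U n)"
  unfolding cheb_U_def by (rule theI'[OF cheb_U_ex1])

lemma cheb_U_eqI: "is_cheb_U n p \<Longrightarrow> cheb_U n = p"
  using is_cheb_U_cheb_U is_cheb_U_unique by blast

lemma cheb_U_0: "cheb_U 0 = 1"
  and cheb_U_1: "cheb_U (Suc 0) = [:0, 2:]"
  and cheb_U_rec: "cheb_U (Suc (Suc n)) = [:0, 2:] * cheb_U (Suc n) - cheb_U n"
  by (rule cheb_U_eqI is_cheb_U_0 is_cheb_U_1 is_cheb_U_step is_cheb_U_cheb_U)+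

lemma degree_cheb_U_le: "degree (cheb_U n) \<le> n"
  using is_cheb_U_exists[of n] cheb_U_eqI by blast

(* The form y^n p(x/y), meant for degree p <= n. It is written out in coefficients because in HOL
   y^n * p(x/y) would take the wrong value (division by 0) on the line y = 0. *)
definition homogenization :: "nat \<Rightarrow> real poly \<Rightarrow> real \<Rightarrow> real \<Rightarrow> real" where
  "homogenization n p x y = (\<Sum>i\<le>n. coeff p i * x ^ i * y ^ (n - i))"

lemma homogenization_eq:
  assumes "degree p \<le> n" "y \<noteq> 0"
  shows "homogenization n p x y = y ^ n * poly p (x / y)"
proof -
  have "poly p (x / y) = (\<Sum>i\<le>n. coeff p i * (x / y) ^ i)"
    unfolding poly_altdef using assms(1)
    by (intro sum.mono_neutral_left) (auto simp: coeff_eq_0)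
  moreover have "y ^ n * (coeff p i * (x / y) ^ i) = coeff p i * x ^ i * y ^ (n - i)" if "i \<le> n" for i
    using assms(2) that by (simp add: power_divide power_diff)
  hence "(\<Sum>i\<le>n. y ^ n * (coeff p i * (x / y) ^ i)) = homogenization n p x y"
    unfolding homogenization_def by (intro sum.cong) (simp_all del: mult_cancel_left)
  ultimately show ?thesis
    by (simp only: sum_distrib_left)
qed

definition cheb_U_form :: "nat \<Rightarrow> real \<Rightarrow> real \<Rightarrow> real" where
  "cheb_U_form n = homogenization n (cheb_U n)"

definition form_area :: "(real \<Rightarrow> real \<Rightarrow> real) \<Rightarrow> real" where
  "form_area F = measure lborel {(x, y). \<bar>F x y\<bar> \<le> 1}"

(* HOL-Analysis defines Beta through Gamma; this is the integral form. *)
lemma Beta_eq_integral: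
  fixes a b :: real
  assumes "a > 0" "b > 0"
  shows "Beta a b = integral {0..1} (\<lambda>t. t powr (a - 1) * (1 - t) powr (b - 1))"
  using has_integral_Beta_real[OF assms] by (simp add: has_integral_iff)

end

theory Submission
  imports Defs "HOL-Real_Asymp.Real_Asymp"
begin

text \<open>
  Integrating along the lines through the origin, the area equals
  \<open>\<integral> \<bar>U\<^sub>n(x)\<bar> powr (-2/n) dx\<close> over the real line.

  For \<open>x > 1\<close> put \<open>s = x - sqrt (x\<^sup>2 - 1)\<close>. Then \<open>U\<^sub>n(x)\<close> is the sum of the
  \<open>s powr (2 k - n)\<close> for \<open>0 \<le> k \<le> n\<close>, so it lies between its largest term and \<open>n + 1\<close> times that
  term. As \<open>s\<^sup>2\<close> has integral \<open>1/3\<close> over \<open>x > 1\<close>, the two unbounded pieces together contribute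
  between \<open>2/3 (n + 1) powr (-2/n)\<close> and \<open>2/3\<close>.

  For \<open>\<bar>x\<bar> \<le> 1\<close> the substitution \<open>x = - cos \<theta>\<close> gives the integral over \<open>[0, \<pi>]\<close> of \<open>h g\<close>, where
  \<open>h = \<bar>sin ((n + 1) \<theta>)\<bar> powr (-2/n) \<ge> 1\<close> almost everywhere and \<open>g = sin \<theta> powr (1 + 2/n) \<le> 1\<close>. Hence
  \<open>g \<le> h g \<le> h + g - 1\<close>. The integral of \<open>g\<close> is a beta value, and so is that of \<open>h\<close>, because by
  periodicity the factor \<open>n + 1\<close> may be dropped.
\<close>

section \<open>The area of a binary form as an integral over slopes\<close>

text \<open>This evaluates the integral over \<open>y\<close> for a fixed slope \<open>t\<close>,
  with \<open>c\<close> standing for \<bar>p(t)\<bar>; the weight \<bar>y\<bar> is the Jacobian of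
  (t, y) -> (y t, y). The set is the interval [-M, M] with M = \<open>c powr (- 1 / real n)\<close>,
  so the integral is the square of M.\<close>

lemma nn_integral_abs_power_le_one:
  fixes c :: real
  assumes c: "c > 0" and n: "n > 0"
  shows "(\<integral>\<^sup>+y. ennreal \<bar>y\<bar> * indicator {y. \<bar>y\<bar> ^ n * c \<le> 1} y \<partial>lborel) = ennreal (c powr (- 2 / real n))"
proof -
  define M where "M = c powr (- 1 / real n)"
  have M: "M > 0" using c by (simp add: M_def)
  have Mn: "M ^ n * c = 1"
  proof -
    have "M ^ n = M powr real n" using M by (simp add: powr_realpow)
    also have "\<dots> = c powr (-1)" using n by (simp add: M_def powr_powr)
    also have "\<dots> = 1 / c" using c by (simp add: powr_minus_divide)
    finally show ?thesis using c by simp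
  qed
  have set: "{y. \<bar>y\<bar> ^ n * c \<le> 1} = {-M..M}"
  proof -
    have eq: "\<bar>y\<bar> ^ n * c \<le> 1 \<longleftrightarrow> \<bar>y\<bar> \<le> M" for y :: real
    proof -
      have "\<bar>y\<bar> ^ n * c \<le> 1 \<longleftrightarrow> \<bar>y\<bar> ^ n \<le> M ^ n"
        using Mn c mult_le_cancel_right_pos[of c "\<bar>y\<bar> ^ n" "M ^ n"] by simp
      also have "\<dots> \<longleftrightarrow> \<bar>y\<bar> \<le> M" using M n by simp
      finally show ?thesis .
    qed
    have "{y. \<bar>y\<bar> ^ n * c \<le> 1} = {y. \<bar>y\<bar> \<le> M}" by (rule Collect_cong) (rule eq)
    also have "\<dots> = {-M..M}" by auto
    finally show ?thesis .
  qed
  have deriv: "((\<lambda>y::real. y * \<bar>y\<bar> / 2) has_real_derivative \<bar>y\<bar>) (at y)" for y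
  proof (cases "y = 0")
    case True
    have "(\<lambda>h::real. \<bar>h\<bar> / 2) \<midarrow>0\<rightarrow> 0" by (auto intro!: tendsto_eq_intros)
    hence "(\<lambda>h::real. (h * \<bar>h\<bar> / 2) / h) \<midarrow>0\<rightarrow> 0"
      by (rule Lim_transform_eventually) (auto simp: eventually_at_filter)
    thus ?thesis using True by (simp add: has_field_derivative_iff)
  next
    case False
    hence "((\<lambda>y::real. \<bar>y\<bar>) has_real_derivative sgn y) (at y)" 
      using has_derivative_norm[of y]
      by (simp add: has_field_derivative_def mult_commute_abs real_norm_def[abs_def])
    hence "((\<lambda>y::real. y * \<bar>y\<bar> / 2) has_real_derivative (1 * \<bar>y\<bar> + sgn y * y) / 2) (at y)"
      by (intro DERIV_cdivide DERIV_mult DERIV_ident)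
    moreover have "(1 * \<bar>y\<bar> + sgn y * y) / 2 = \<bar>y\<bar>" by (simp add: sgn_if)
    ultimately show ?thesis by simp
  qed
  have "(\<integral>\<^sup>+y. ennreal \<bar>y\<bar> * indicator {y. \<bar>y\<bar> ^ n * c \<le> 1} y \<partial>lborel)
      = (\<integral>\<^sup>+y. ennreal \<bar>y\<bar> * indicator {-M..M} y \<partial>lborel)"
    by (simp only: set)
  also have "\<dots> = ennreal (M * \<bar>M\<bar> / 2 - (- M) * \<bar>- M\<bar> / 2)"
    using M deriv by (intro nn_integral_FTC_Icc) (auto intro: DERIV_subset has_field_derivative_at_within)
  also have "M * \<bar>M\<bar> / 2 - (- M) * \<bar>- M\<bar> / 2 = M * M" using M by simp
  also have "\<dots> = c powr (- 2 / real n)" by (simp add: M_def powr_add [symmetric])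
  finally show ?thesis .
qed

lemma measurable_homogenization:
  "(\<lambda>z. homogenization n p (fst z) (snd z)) \<in> borel_measurable borel"
  unfolding homogenization_def
  by (intro borel_measurable_continuous_onI continuous_intros)

text \<open>On each line of constant y \<noteq> 0 the substitution x = y t turns the form into y^n
  p(t). After exchanging the integrals, the one over y is the preceding computation for almost every
  t, as the roots of \<open>p\<close> are finite in number. Working with \<open>emeasure\<close>
  leaves an infinite area possible at this stage.\<close>

lemma emeasure_homogenization:
  fixes p :: "real poly"
  assumes deg: "degree p \<le> n" and n: "n > 0" and p: "p \<noteq> 0"
  shows "emeasure lborel {(x, y). \<bar>homogenization n p x y\<bar> \<le> 1}
       = (\<integral>\<^sup>+t. ennreal (\<bar>poly p t\<bar> powr (- 2 / real n)) \<partial>lborel)"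
proof -
  define S where "S = {(x, y). \<bar>homogenization n p x y\<bar> \<le> 1}"
  have S_eq: "S = {z \<in> space borel. \<bar>homogenization n p (fst z) (snd z)\<bar> \<le> 1}"
    by (auto simp: S_def)
  have Sb: "S \<in> sets (lborel \<Otimes>\<^sub>M lborel)"
    unfolding lborel_prod S_eq using measurable_homogenization[of n p, measurable] by measurable
  define f :: "real \<Rightarrow> real \<Rightarrow> ennreal"
    where "f t y = ennreal \<bar>y\<bar> * indicator {y. \<bar>y\<bar> ^ n * \<bar>poly p t\<bar> \<le> 1} y" for t y
  have fm: "case_prod f \<in> borel_measurable (lborel \<Otimes>\<^sub>M lborel)"
  proof -
    have "(\<lambda>z. \<bar>snd z\<bar> ^ n * \<bar>poly p (fst z)\<bar>) \<in> borel_measurable (lborel \<Otimes>\<^sub>M lborel :: (real \<times> real) measure)"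
      unfolding lborel_prod by (simp, intro borel_measurable_continuous_onI continuous_intros)
    note [measurable] = this
    have "case_prod f = (\<lambda>z. ennreal \<bar>snd z\<bar> *
        indicator {z \<in> space (lborel \<Otimes>\<^sub>M lborel). \<bar>snd z\<bar> ^ n * \<bar>poly p (fst z)\<bar> \<le> 1} z)"
      by (auto simp: f_def indicator_def fun_eq_iff space_pair_measure)
    also have "\<dots> \<in> borel_measurable (lborel \<Otimes>\<^sub>M lborel)" by measurable
    finally show ?thesis .
  qed
  have inner: "emeasure lborel ((\<lambda>x. (x, y)) -` S) = (\<integral>\<^sup>+t. f t y \<partial>lborel)" if y: "y \<noteq> 0" for y
  proof -
    have sy: "(\<lambda>x. (x, y)) -` S \<in> sets borel"
      using sets_Pair2[OF Sb, of y] by simp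
    have "emeasure lborel ((\<lambda>x. (x, y)) -` S) = (\<integral>\<^sup>+x. indicator ((\<lambda>x. (x, y)) -` S) x \<partial>lborel)"
      using sy by simp
    also have "\<dots> = ennreal \<bar>y\<bar> * (\<integral>\<^sup>+t. indicator ((\<lambda>x. (x, y)) -` S) (0 + y * t) \<partial>lborel)"
      using sy y by (intro nn_integral_real_affine) auto
    also have "\<dots> = (\<integral>\<^sup>+t. ennreal \<bar>y\<bar> * indicator ((\<lambda>x. (x, y)) -` S) (0 + y * t) \<partial>lborel)"
      by (rule nn_integral_cmult [symmetric]) (use sy in measurable)
    also have "\<dots> = (\<integral>\<^sup>+t. f t y \<partial>lborel)"
      using y by (intro nn_integral_cong)
        (auto simp: f_def S_def indicator_def homogenization_eq[OF deg] abs_mult power_abs)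
    finally show ?thesis .
  qed
  have "emeasure lborel S = (\<integral>\<^sup>+y. emeasure lborel ((\<lambda>x. (x, y)) -` S) \<partial>lborel)"
    using lborel_pair.emeasure_pair_measure_alt2[OF Sb] by (simp add: lborel_prod)
  also have "\<dots> = (\<integral>\<^sup>+y. (\<integral>\<^sup>+t. f t y \<partial>lborel) \<partial>lborel)"
    \<comment> \<open>The line y = 0, which the slope coordinate misses, is a null set.\<close>
    using AE_lborel_singleton[of "0::real"] by (intro nn_integral_cong_AE) (auto simp: inner)
  also have "\<dots> = (\<integral>\<^sup>+t. (\<integral>\<^sup>+y. f t y \<partial>lborel) \<partial>lborel)"
    by (rule lborel_pair.Fubini') (rule fm)
  also have "\<dots> = (\<integral>\<^sup>+t. ennreal (\<bar>poly p t\<bar> powr (- 2 / real n)) \<partial>lborel)"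
  proof (rule nn_integral_cong_AE)
    have "AE t in lborel. t \<notin> {t. poly p t = 0}"
      using poly_roots_finite[OF p] by (intro AE_not_in finite_imp_null_set_lborel)
    thus "AE t in lborel. (\<integral>\<^sup>+y. f t y \<partial>lborel) = ennreal (\<bar>poly p t\<bar> powr (- 2 / real n))"
      by eventually_elim (simp add: f_def nn_integral_abs_power_le_one n)
  qed
  finally show ?thesis by (simp add: S_def)
qed

section \<open>Growth and parity of the Chebyshev polynomials\<close>

text \<open>The numbers \<open>w\<close> and \<open>s\<close> are the roots of z^2 - 2 x z + 1, the
  characteristic polynomial of the three-term recurrence. Splitting off the root \<open>w\<close>
  leaves a first-order recurrence whose remainder is a power of \<open>s\<close>.\<close>

lemma cheb_U_Suc_factored:
  assumes "w + s = 2 * x" "w * s = 1"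
  shows "poly (cheb_U (Suc n)) x = w * poly (cheb_U n) x + s ^ Suc n"
proof (induction n)
  case 0
  show ?case using assms by (simp add: cheb_U_0 cheb_U_1 algebra_simps)
next
  case (Suc n)
  \<comment> \<open>Multiplying by \<open>s\<close> expresses U_n through U_(n+1), which eliminates
    U_n from the three-term recurrence.\<close>
  have "s * poly (cheb_U (Suc n)) x = (w * s) * poly (cheb_U n) x + s ^ Suc (Suc n)"
    by (simp add: Suc algebra_simps)
  hence "s * poly (cheb_U (Suc n)) x = poly (cheb_U n) x + s ^ Suc (Suc n)"
    using assms(2) by simp
  moreover have "poly (cheb_U (Suc (Suc n))) x = (w + s) * poly (cheb_U (Suc n)) x - poly (cheb_U n) x"
    by (simp add: cheb_U_rec assms(1))
  ultimately show ?case by (simp add: algebra_simps)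
qed

text \<open>Each step of the first-order recurrence multiplies by \<open>w\<close> and adds a power
  of \<open>s\<close> that lies strictly between 0 and the same power of \<open>w\<close>.\<close>

lemma cheb_U_gt_one_bounds:
  fixes w s x :: real
  assumes ws: "w + s = 2 * x" "w * s = 1" and w: "w > 1" and n: "n > 0"
  shows "w ^ n < poly (cheb_U n) x" "poly (cheb_U n) x < real (n + 1) * w ^ n"
proof -
  have s: "s > 0" using ws(2) w by (metis less_trans zero_less_one zero_less_mult_pos)
  have "s < 1" using ws(2) w s by (metis mult.commute mult_less_cancel_left_pos mult.right_neutral)
  hence sw: "s < w" using w by linarith
  \<comment> \<open>At n = 0 all quantities equal 1, so the induction carries weak bounds;
    strictness appears anew at every successor.\<close>
  have weak: "w ^ n \<le> poly (cheb_U n) x \<and> poly (cheb_U n) x \<le> real (n + 1) * w ^ n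
      \<and> (n > 0 \<longrightarrow> w ^ n < poly (cheb_U n) x \<and> poly (cheb_U n) x < real (n + 1) * w ^ n)" for n
  proof (induction n)
    case 0
    show ?case by (simp add: cheb_U_0)
  next
    case (Suc n)
    have a: "w * w ^ n \<le> w * poly (cheb_U n) x" "w * poly (cheb_U n) x \<le> w * (real (n + 1) * w ^ n)"
      using Suc w by (auto intro!: mult_left_mono)
    have b: "0 < s ^ Suc n" "s ^ Suc n < w ^ Suc n"
      using s power_strict_mono[OF sw, of "Suc n"] by simp_all
    have c: "real (Suc n + 1) * w ^ Suc n = w * (real (n + 1) * w ^ n) + w ^ Suc n"
      by (simp add: algebra_simps)
    have "w ^ Suc n < poly (cheb_U (Suc n)) x"
      unfolding cheb_U_Suc_factored[OF ws] using a b by simp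
    moreover have "poly (cheb_U (Suc n)) x < real (Suc n + 1) * w ^ Suc n"
      unfolding cheb_U_Suc_factored[OF ws] c using a b by linarith
    ultimately show ?case by simp
  qed
  show "w ^ n < poly (cheb_U n) x" "poly (cheb_U n) x < real (n + 1) * w ^ n"
    using weak[of n] n by auto
qed

text \<open>U_n has the parity of n. This reduces x < -1 to x > 1 and absorbs the sign in x = - cos
  \<theta>.\<close>

lemma abs_poly_cheb_U_minus: "\<bar>poly (cheb_U n) (- x)\<bar> = \<bar>poly (cheb_U n) x\<bar>"
proof -
  have "poly (cheb_U n) (- x) = (- 1) ^ n * poly (cheb_U n) x"
    by (induction n rule: induct_nat_012) (simp_all add: cheb_U_0 cheb_U_1 cheb_U_rec algebra_simps)
  thus ?thesis by (simp add: abs_mult)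
qed

lemma cheb_U_nonzero: "cheb_U n \<noteq> 0"
proof (cases "n = 0")
  case False
  \<comment> \<open>The point 5/4 is (w + s) / 2 for w = 2 and s = 1/2.\<close>
  have "(2::real) ^ n < poly (cheb_U n) (5/4)"
    by (rule cheb_U_gt_one_bounds(1)[of 2 "1/2"]) (use False in auto)
  moreover have "(0::real) < 2 ^ n" by simp
  ultimately show ?thesis by auto
qed (simp add: cheb_U_0)

section \<open>Periodic integrands and powers of sine\<close>

lemma nn_integral_interval_split:
  fixes f :: "real \<Rightarrow> ennreal"
  assumes [measurable]: "f \<in> borel_measurable borel" and "a \<le> b" "b \<le> c"
  shows "(\<integral>\<^sup>+x. f x * indicator {a..c} x \<partial>lborel)
       = (\<integral>\<^sup>+x. f x * indicator {a..b} x \<partial>lborel) + (\<integral>\<^sup>+x. f x * indicator {b..c} x \<partial>lborel)"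
proof -
  have "(\<integral>\<^sup>+x. f x * indicator {a..c} x \<partial>lborel)
      = (\<integral>\<^sup>+x. f x * indicator {a..b} x + f x * indicator {b..c} x \<partial>lborel)"
    using AE_lborel_singleton[of b] assms(2,3)
    by (intro nn_integral_cong_AE) (auto elim!: eventually_mono simp: indicator_def)
  thus ?thesis by (simp add: nn_integral_add)
qed

lemma nn_integral_periodic_shift:
  fixes f :: "real \<Rightarrow> ennreal"
  assumes [measurable]: "f \<in> borel_measurable borel" and per: "\<And>x. f (x + T) = f x"
  shows "(\<integral>\<^sup>+x. f x * indicator {a + T..b + T} x \<partial>lborel) = (\<integral>\<^sup>+x. f x * indicator {a..b} x \<partial>lborel)"
proof -
  have "(\<integral>\<^sup>+x. f x * indicator {a + T..b + T} x \<partial>lborel)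
      = ennreal \<bar>1\<bar> * (\<integral>\<^sup>+x. f (T + 1 * x) * indicator {a + T..b + T} (T + 1 * x) \<partial>lborel)"
    by (rule nn_integral_real_affine) auto
  also have "\<dots> = (\<integral>\<^sup>+x. f x * indicator {a..b} x \<partial>lborel)"
    by (auto simp: add.commute[of T] per indicator_def intro!: nn_integral_cong)
  finally show ?thesis .
qed

text \<open>Rescaling makes the left side 1/m of an integral over m periods, all of which contribute
  equally. This removes the frequency n + 1 from \<bar>sin ((n + 1) \<theta>)\<bar>.\<close>

lemma nn_integral_periodic_scale:
  fixes f :: "real \<Rightarrow> ennreal" and m :: nat
  assumes meas [measurable]: "f \<in> borel_measurable borel" and per: "\<And>x. f (x + T) = f x"
    and T: "T > 0" and m: "m > 0"
  shows "(\<integral>\<^sup>+x. f (real m * x) * indicator {0..T} x \<partial>lborel) = (\<integral>\<^sup>+x. f x * indicator {0..T} x \<partial>lborel)"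
    (is "?L = ?I")
proof -
  have perk: "f (x + real k * T) = f x" for x k
  proof (induction k)
    case (Suc k)
    have "f (x + real (Suc k) * T) = f ((x + real k * T) + T)" by (simp add: algebra_simps)
    thus ?case using Suc per by simp
  qed simp
  have mult: "(\<integral>\<^sup>+x. f x * indicator {0..real k * T} x \<partial>lborel) = of_nat k * ?I" for k
  proof (induction k)
    case 0
    have "(\<integral>\<^sup>+x. f x * indicator {0..0} x \<partial>lborel) = (\<integral>\<^sup>+(x::real). 0 \<partial>lborel)"
      using AE_lborel_singleton[of "0::real"]
      by (intro nn_integral_cong_AE) (auto elim!: eventually_mono)
    thus ?case by simp
  next
    case (Suc k)
    have "(\<integral>\<^sup>+x. f x * indicator {0..real (Suc k) * T} x \<partial>lborel)
      = (\<integral>\<^sup>+x. f x * indicator {0..real k * T} x \<partial>lborel)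
        + (\<integral>\<^sup>+x. f x * indicator {real k * T..real (Suc k) * T} x \<partial>lborel)"
      using T by (intro nn_integral_interval_split) (auto intro: mult_right_mono)
    also have "(\<integral>\<^sup>+x. f x * indicator {real k * T..real (Suc k) * T} x \<partial>lborel) = ?I"
      using nn_integral_periodic_shift[of f "real k * T" 0 T] perk
      by (simp add: algebra_simps)
    finally show ?case unfolding Suc by (simp add: distrib_right add.commute)
  qed
  have "of_nat m * ?I = (\<integral>\<^sup>+x. f x * indicator {0..real m * T} x \<partial>lborel)"
    by (rule mult [symmetric])
  also have "\<dots> = ennreal \<bar>real m\<bar> * (\<integral>\<^sup>+x. f (0 + real m * x) * indicator {0..real m * T} (0 + real m * x) \<partial>lborel)"
    by (rule nn_integral_real_affine) (use m in auto)
  also have "\<dots> = of_nat m * ?L"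
    using m by (auto simp: indicator_def ennreal_of_nat_eq_real_of_nat zero_le_mult_iff
      intro!: nn_integral_cong arg_cong[of _ _ "\<lambda>x. _ * x"])
  finally show ?thesis
    using m by (auto simp: ennreal_mult_cancel_left)
qed

text \<open>The substitution t = (sin x)^2 carries the beta integral to [0, pi/2] with a factor 2,
  and reflection in pi/2 uses that factor to cover [0, pi]. The condition a > -1 makes the first
  beta argument positive.\<close>

lemma nn_integral_sin_powr:
  fixes a :: real
  assumes a: "a > - 1"
  shows "(\<integral>\<^sup>+x. ennreal (sin x powr a) * indicator {0..pi} x \<partial>lborel) = ennreal (Beta ((1 + a) / 2) (1 / 2))"
proof -
  define h where "h x = ennreal (sin x powr a)" for x :: real
  have [measurable]: "h \<in> borel_measurable borel" unfolding h_def by measurable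
  have "(\<integral>\<^sup>+x. h x * indicator {0..pi / 2} x \<partial>lborel)
      = ennreal \<bar>-1\<bar> * (\<integral>\<^sup>+x. h (pi + (- 1) * x) * indicator {0..pi / 2} (pi + (- 1) * x) \<partial>lborel)"
    by (rule nn_integral_real_affine) auto
  also have "\<dots> = (\<integral>\<^sup>+x. h x * indicator {pi / 2..pi} x \<partial>lborel)"
    by (auto simp: h_def indicator_def intro!: nn_integral_cong)
  finally have reflect: "(\<integral>\<^sup>+x. h x * indicator {0..pi / 2} x \<partial>lborel)
      = (\<integral>\<^sup>+x. h x * indicator {pi / 2..pi} x \<partial>lborel)" .
  have "((\<lambda>t. t powr ((a - 1) / 2) * (1 - t) powr (-1 / 2)) has_integral Beta ((1 + a) / 2) (1 / 2)) {0..1}"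
    using has_integral_Beta_real[of "(1 + a) / 2" "1 / 2"] a by (simp add: field_simps)
  from nn_integral_has_integral_lebesgue[OF _ this]
  have "ennreal (Beta ((1 + a) / 2) (1 / 2)) =
      (\<integral>\<^sup>+t. ennreal (t powr ((a - 1) / 2) * (1 - t) powr (-1 / 2) * indicator {(sin 0)\<^sup>2..(sin (pi / 2))\<^sup>2} t) \<partial>lborel)"
    by (simp add: mult_ac ennreal_mult' ennreal_indicator)
  also have "\<dots> = (\<integral>\<^sup>+x. ennreal ((sin x)\<^sup>2 powr ((a - 1) / 2) * (1 - (sin x)\<^sup>2) powr (-1 / 2)
      * (2 * sin x * cos x) * indicator {0..pi / 2} x) \<partial>lborel)"
    by (subst nn_integral_substitution[where g = "\<lambda>x. (sin x)\<^sup>2" and g' = "\<lambda>x. 2 * sin x * cos x"])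
       (auto intro!: derivative_eq_intros continuous_intros mult_nonneg_nonneg sin_ge_zero cos_ge_zero
         simp: set_borel_measurable_def)
  also have "\<dots> = (\<integral>\<^sup>+x. 2 * (h x * indicator {0..pi / 2} x) \<partial>lborel)"
  proof (rule nn_integral_cong_AE)
    \<comment> \<open>Off the endpoints both sine and cosine are positive. At pi/2 the identity
      fails: the left side is 0 there and the right side is 2.\<close>
    have "AE x in lborel. x \<noteq> 0 \<and> x \<noteq> pi / 2"
      using AE_lborel_singleton[of "0::real"] AE_lborel_singleton[of "pi / 2"] by eventually_elim auto
    thus "AE x in lborel. ennreal ((sin x)\<^sup>2 powr ((a - 1) / 2) * (1 - (sin x)\<^sup>2) powr (-1 / 2)
      * (2 * sin x * cos x) * indicator {0..pi / 2} x) = 2 * (h x * indicator {0..pi / 2} x)"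
    proof eventually_elim
      case (elim x)
      show ?case
      proof (cases "x \<in> {0..pi / 2}")
        case True
        with elim have x: "0 < x" "x < pi / 2" by auto
        have s: "sin x > 0" using x by (intro sin_gt_zero) auto
        have c: "cos x > 0" using x by (intro cos_gt_zero) auto
        have "(sin x)\<^sup>2 powr ((a - 1) / 2) = (sin x powr 2) powr ((a - 1) / 2)"
          using s by simp
        also have "\<dots> = sin x powr (2 * ((a - 1) / 2))" by (rule powr_powr)
        also have "2 * ((a - 1) / 2) = a - 1" by simp
        finally have "(sin x)\<^sup>2 powr ((a - 1) / 2) = sin x powr (a - 1)" .
        moreover have "(1 - (sin x)\<^sup>2) powr (-1 / 2) = cos x powr (-1)"
          using c powr_powr[of "cos x" 2 "-1/2"] by (simp add: cos_squared_eq [symmetric] powr_numeral)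
        moreover have "sin x powr (a - 1) * sin x = sin x powr a"
          using s by (simp add: powr_diff)
        moreover have "cos x powr (-1) * cos x = 1" using c by (simp add: powr_minus)
        ultimately have eq: "(sin x)\<^sup>2 powr ((a - 1) / 2) * (1 - (sin x)\<^sup>2) powr (-1 / 2) * (2 * sin x * cos x)
          = 2 * sin x powr a"
          by (metis (no_types, opaque_lifting) mult.assoc mult.commute mult.right_neutral)
        show ?thesis unfolding eq using True by (simp add: h_def ennreal_mult')
      qed auto
    qed
  qed
  also have "\<dots> = 2 * (\<integral>\<^sup>+x. h x * indicator {0..pi / 2} x \<partial>lborel)"
    by (rule nn_integral_cmult) measurable
  also have "\<dots> = (\<integral>\<^sup>+x. h x * indicator {0..pi / 2} x \<partial>lborel) + (\<integral>\<^sup>+x. h x * indicator {0..pi / 2} x \<partial>lborel)"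
    by (simp add: mult_2)
  also have "\<dots> = (\<integral>\<^sup>+x. h x * indicator {0..pi} x \<partial>lborel)"
    by (subst nn_integral_interval_split[of h 0 "pi / 2" pi]) (auto simp: reflect)
  finally show ?thesis by (simp add: h_def)
qed

section \<open>The unbounded pieces\<close>

text \<open>With s = x - sqrt (x^2 - 1) one has 2 x = s + 1/s, so s^2 dx = (s^2 - 1) / 2 ds, which
  gives the antiderivative \<open>F\<close>. As x runs from 1 to infinity, s falls from 1 to 0 and
  \<open>F\<close> rises from -1/3 to 0.\<close>

lemma nn_integral_joukowski_inverse_square:
  "(\<integral>\<^sup>+x. ennreal ((x - sqrt (x\<^sup>2 - 1))\<^sup>2) * indicator {1<..} x \<partial>lborel) = ennreal (1 / 3)"
proof -
  define s where "s x = x - sqrt (x\<^sup>2 - 1)" for x :: real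
  define F where "F x = (s x ^ 3 / 3 - s x) / 2" for x
  have deriv: "(F has_real_derivative (s x)\<^sup>2) (at x)" if x: "x > 1" for x
  proof -
    define r where "r = sqrt (x\<^sup>2 - 1)"
    have x2: "x\<^sup>2 - 1 > 0" using x by (simp add: one_less_power)
    hence r: "r > 0" "r * r = x\<^sup>2 - 1" by (auto simp: r_def)
    define d where "d = 1 - x / r"
    have ds: "(s has_real_derivative d) (at x)"
      unfolding s_def [abs_def] d_def using x2 by (auto intro!: derivative_eq_intros simp: r_def field_simps)
    have "(F has_real_derivative (3 * (s x)\<^sup>2 * d / 3 - d) / 2) (at x)"
      unfolding F_def [abs_def] by (auto intro!: derivative_eq_intros ds)
    moreover have "(3 * (s x)\<^sup>2 * d / 3 - d) / 2 = (s x)\<^sup>2"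
    proof -
      have sx: "s x = x - r" by (simp add: s_def r_def)
      \<comment> \<open>The derivative \<open>d\<close> of s and the factor s^2 - 1 = -2 r s are
        combined through d r = -s, so that \<open>r\<close> cancels.\<close>
      have dr: "d * r = - s x" using r(1) by (simp add: sx d_def field_simps)
      have "(3 * (s x)\<^sup>2 * d / 3 - d) / 2 = ((s x)\<^sup>2 - 1) * d / 2"
        by (simp add: algebra_simps)
      also have "(s x)\<^sup>2 - 1 = - 2 * r * s x"
        using r(2) by (simp add: sx power2_eq_square algebra_simps)
      also have "- 2 * r * s x * d / 2 = - s x * (d * r)" by simp
      also have "\<dots> = (s x)\<^sup>2" unfolding dr by (simp add: power2_eq_square)
      finally show ?thesis .
    qed
    ultimately show ?thesis by simp
  qed
  \<comment> \<open>This holds for every x, since \<open>sqrt\<close> extends to negative arguments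
    as a continuous odd function.\<close>
  have cont: "isCont (\<lambda>x. (s x)\<^sup>2) x" for x
    unfolding s_def by (intro continuous_intros)
  have lim1: "(F \<longlongrightarrow> - 1 / 3) (at_right 1)"
  proof -
    have "isCont F 1" unfolding F_def [abs_def] s_def by (intro continuous_intros) auto
    hence "(F \<longlongrightarrow> F 1) (at_right 1)"
      by (simp add: isCont_def filterlim_at_split)
    thus ?thesis by (simp add: F_def s_def)
  qed
  have lim2: "(F \<longlongrightarrow> 0) at_top"
    unfolding F_def [abs_def] s_def by real_asymp
  have set: "einterval 1 \<infinity> = {1<..}"
    by (auto simp: einterval_def one_ereal_def)
  note FTC = interval_integral_FTC_nonneg[of 1 \<infinity> F "\<lambda>x. (s x)\<^sup>2" "- 1 / 3" 0]
  have prems: "(1::ereal) < \<infinity>" "((F \<circ> real_of_ereal) \<longlongrightarrow> - 1 / 3) (at_right 1)"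
    "((F \<circ> real_of_ereal) \<longlongrightarrow> 0) (at_left \<infinity>)"
    using lim1 lim2 by (simp_all add: one_ereal_def ereal_tendsto_simps)
  have int: "set_integrable lborel {1<..} (\<lambda>x. (s x)\<^sup>2)"
    using FTC(1) prems deriv cont by (auto simp: set one_ereal_def)
  have "(LBINT x=1..\<infinity>. (s x)\<^sup>2) = 0 - (- 1 / 3)"
    using prems deriv cont by (intro FTC(2)) (auto simp: one_ereal_def)
  hence val: "(LINT x:{1<..}|lborel. (s x)\<^sup>2) = 1 / 3"
    by (simp add: interval_lebesgue_integral_def set)
  have "(\<integral>\<^sup>+x. ennreal ((s x)\<^sup>2) * indicator {1<..} x \<partial>lborel)
      = (\<integral>\<^sup>+x. ennreal (indicator {1<..} x *\<^sub>R (s x)\<^sup>2) \<partial>lborel)"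
    by (intro nn_integral_cong) (auto simp: indicator_def)
  also have "\<dots> = ennreal (1 / 3)"
    using int val by (subst nn_integral_eq_integral) (auto simp: set_integrable_def set_lebesgue_integral_def)
  finally show ?thesis by (simp add: s_def)
qed

text \<open>The growth bounds are raised to the negative exponent -2/n, which reverses them and
  turns w^n into w^(-2) = s^2.\<close>

lemma cheb_U_powr_bounds:
  fixes x :: real
  assumes x: "x > 1" and n: "n > 0"
  shows "real (n + 1) powr (- 2 / real n) * (x - sqrt (x\<^sup>2 - 1))\<^sup>2 < \<bar>poly (cheb_U n) x\<bar> powr (- 2 / real n)"
    "\<bar>poly (cheb_U n) x\<bar> powr (- 2 / real n) < (x - sqrt (x\<^sup>2 - 1))\<^sup>2"
proof -
  define r where "r = sqrt (x\<^sup>2 - 1)"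
  define w where "w = x + r"
  define s where "s = x - r"
  have x2: "x\<^sup>2 - 1 > 0" using x by (simp add: one_less_power)
  hence r: "r > 0" "r * r = x\<^sup>2 - 1" by (auto simp: r_def)
  have ws: "w + s = 2 * x" "w * s = 1" "w > 1"
    using r x by (auto simp: w_def s_def algebra_simps power2_eq_square)
  have s: "s = 1 / w" using ws(2,3) by (simp add: field_simps)
  note b = cheb_U_gt_one_bounds[OF ws n]
  have wn: "w ^ n > 0" using ws(3) by simp
  have "(w ^ n) powr (- 2 / real n) = (w powr real n) powr (- 2 / real n)"
    using ws(3) by (simp add: powr_realpow)
  also have "\<dots> = w powr (- 2)" using n by (simp add: powr_powr)
  also have "\<dots> = s\<^sup>2" using ws(3) by (simp add: s powr_minus powr_numeral power_divide divide_inverse power_inverse)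
  finally have e: "(w ^ n) powr (- 2 / real n) = s\<^sup>2" .
  have neg: "- 2 / real n < 0" using n by simp
  have "\<bar>poly (cheb_U n) x\<bar> powr (- 2 / real n) < (w ^ n) powr (- 2 / real n)"
    using b wn by (intro powr_less_mono2_neg neg) auto
  thus "\<bar>poly (cheb_U n) x\<bar> powr (- 2 / real n) < (x - sqrt (x\<^sup>2 - 1))\<^sup>2"
    unfolding e by (simp add: s_def r_def)
  have "(real (n + 1) * w ^ n) powr (- 2 / real n) < \<bar>poly (cheb_U n) x\<bar> powr (- 2 / real n)"
    using b wn by (intro powr_less_mono2_neg neg) auto
  moreover have "(real (n + 1) * w ^ n) powr (- 2 / real n) = real (n + 1) powr (- 2 / real n) * s\<^sup>2"
    using wn e by (subst powr_mult) auto
  ultimately show "real (n + 1) powr (- 2 / real n) * (x - sqrt (x\<^sup>2 - 1))\<^sup>2 < \<bar>poly (cheb_U n) x\<bar> powr (- 2 / real n)"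
    by (simp add: s_def r_def)
qed

text \<open>The pointwise bounds are strict on a set of positive measure, so the integrals differ
  strictly. The strictness of the final area bounds comes from here, the bounds on [-1, 1] being
  weak.\<close>

lemma nn_integral_cheb_U_outer:
  assumes n: "n > 0"
  defines "I \<equiv> (\<integral>\<^sup>+x. ennreal (\<bar>poly (cheb_U n) x\<bar> powr (- 2 / real n)) * indicator {1<..} x \<partial>lborel)"
  shows "I < ennreal (1 / 3)" "ennreal (real (n + 1) powr (- 2 / real n) / 3) < I"
proof -
  define c where "c = real (n + 1) powr (- 2 / real n)"
  define q where "q x = (x - sqrt (x\<^sup>2 - 1))\<^sup>2" for x :: real
  define u where "u x = \<bar>poly (cheb_U n) x\<bar> powr (- 2 / real n)" for x
  have c: "c \<ge> 0" by (simp add: c_def)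
  have q0: "q x \<ge> 0" for x by (simp add: q_def)
  have [measurable]: "q \<in> borel_measurable borel" unfolding q_def by measurable
  have "poly (cheb_U n) \<in> borel_measurable borel"
    by (intro borel_measurable_continuous_onI continuous_intros)
  hence [measurable]: "u \<in> borel_measurable borel" unfolding u_def by measurable
  have lt: "c * q x < u x" "u x < q x" if "x > 1" for x
    using cheb_U_powr_bounds[OF that n] by (simp_all add: c_def q_def u_def)
  have Q: "(\<integral>\<^sup>+x. ennreal (q x) * indicator {1<..} x \<partial>lborel) = ennreal (1 / 3)"
    unfolding q_def by (rule nn_integral_joukowski_inverse_square)
  have cQ: "(\<integral>\<^sup>+x. ennreal (c * q x) * indicator {1<..} x \<partial>lborel) = ennreal (c / 3)"
  proof -
    have "(\<integral>\<^sup>+x. ennreal (c * q x) * indicator {1<..} x \<partial>lborel)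
        = (\<integral>\<^sup>+x. ennreal c * (ennreal (q x) * indicator {1<..} x) \<partial>lborel)"
      using c by (intro nn_integral_cong) (simp add: ennreal_mult' mult.assoc)
    also have "\<dots> = ennreal c * ennreal (1 / 3)"
      by (subst nn_integral_cmult) (auto simp: Q)
    finally show ?thesis using c by (simp add: ennreal_mult' [symmetric])
  qed
  have I: "I = (\<integral>\<^sup>+x. ennreal (u x) * indicator {1<..} x \<partial>lborel)"
    by (simp add: I_def u_def)
  \<comment> \<open>The weak bound comes first because the strict comparison asks for
    \<open>I\<close> to be finite.\<close>
  have le: "I \<le> ennreal (1 / 3)"
    unfolding I Q [symmetric] using lt(2)
    by (intro nn_integral_mono) (auto simp: indicator_def intro!: ennreal_leI intro: less_imp_le)
  have strict: "\<not> (AE x in lborel. ennreal (g x) * indicator {1<..} x \<le> ennreal (f x) * indicator {1<..} x)"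
    if fg: "\<And>x. x > 1 \<Longrightarrow> f x < g x" "\<And>x. x > 1 \<Longrightarrow> f x \<ge> 0" for f g :: "real \<Rightarrow> real"
  proof
    assume "AE x in lborel. ennreal (g x) * indicator {1<..} x \<le> ennreal (f x) * indicator {1<..} x"
    \<comment> \<open>Any subset of x > 1 with positive measure would do; this one has measure
      1.\<close>
    hence "AE x in lborel. x \<notin> {1<..(2::real)}"
    proof eventually_elim
      case (elim x)
      show ?case
      proof
        assume "x \<in> {1<..2}"
        hence "x > 1" by simp
        thus False using elim fg[of x] by (simp add: ennreal_le_iff)
      qed
    qed
    hence "{1<..(2::real)} \<in> null_sets lborel" by (subst AE_iff_null_sets) auto
    thus False by (simp add: null_sets_def)
  qed
  show "I < ennreal (1 / 3)"
    unfolding I Q [symmetric]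
  proof (rule nn_integral_less)
    show "(\<integral>\<^sup>+x. ennreal (u x) * indicator {1<..} x \<partial>lborel) \<noteq> \<infinity>"
      using le by (auto simp: I top_unique)
    show "\<not> (AE x in lborel. ennreal (q x) * indicator {1<..} x \<le> ennreal (u x) * indicator {1<..} x)"
      using lt(2) by (rule strict) (auto simp: u_def)
  qed (use lt(2) in \<open>auto simp: indicator_def intro!: ennreal_leI intro: less_imp_le\<close>)
  show "ennreal (real (n + 1) powr (- 2 / real n) / 3) < I"
    unfolding I c_def [symmetric] cQ [symmetric]
  proof (rule nn_integral_less)
    show "(\<integral>\<^sup>+x. ennreal (c * q x) * indicator {1<..} x \<partial>lborel) \<noteq> \<infinity>"
      by (simp add: cQ)
    show "\<not> (AE x in lborel. ennreal (u x) * indicator {1<..} x \<le> ennreal (c * q x) * indicator {1<..} x)"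
      using lt(1) by (rule strict) (auto simp: c q0)
  qed (use lt(1) in \<open>auto simp: indicator_def intro!: ennreal_leI intro: less_imp_le\<close>)
qed

section \<open>The bounded piece\<close>

lemma nn_integral_cheb_U_inner:
  "(\<integral>\<^sup>+x. ennreal (\<bar>poly (cheb_U n) x\<bar> powr (- 2 / real n)) * indicator {-1..1} x \<partial>lborel)
    = (\<integral>\<^sup>+x. ennreal (\<bar>sin (real (n + 1) * x)\<bar> powr (- 2 / real n) * sin x powr (1 + 2 / real n))
        * indicator {0..pi} x \<partial>lborel)"
proof -
  define u where "u x = \<bar>poly (cheb_U n) x\<bar> powr (- 2 / real n)" for x
  define a where "a = 2 / real n"
  have "poly (cheb_U n) \<in> borel_measurable borel"
    by (intro borel_measurable_continuous_onI continuous_intros)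
  hence [measurable]: "u \<in> borel_measurable borel" unfolding u_def by measurable
  have "(\<integral>\<^sup>+x. ennreal (u x) * indicator {-1..1} x \<partial>lborel)
      = (\<integral>\<^sup>+x. ennreal (u x * indicator {- cos 0..- cos pi} x) \<partial>lborel)"
    by (intro nn_integral_cong) (auto simp: indicator_def)
  \<comment> \<open>The map is - cos and not cos because the substitution rule requires a
    nonnegative derivative.\<close>
  also have "\<dots> = (\<integral>\<^sup>+x. ennreal (u (- cos x) * sin x * indicator {0..pi} x) \<partial>lborel)"
    by (rule nn_integral_substitution[where g = "\<lambda>x. - cos x" and g' = sin])
      (auto intro!: derivative_eq_intros continuous_intros sin_ge_zero simp: set_borel_measurable_def)
  also have "\<dots> = (\<integral>\<^sup>+x. ennreal (\<bar>sin (real (n + 1) * x)\<bar> powr - a * sin x powr (1 + a))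
        * indicator {0..pi} x \<partial>lborel)"
  proof (rule nn_integral_cong_AE)
    have "AE x in lborel. x \<noteq> 0 \<and> x \<noteq> pi"
      using AE_lborel_singleton[of "0::real"] AE_lborel_singleton[of pi] by eventually_elim auto
    thus "AE x in lborel. ennreal (u (- cos x) * sin x * indicator {0..pi} x)
      = ennreal (\<bar>sin (real (n + 1) * x)\<bar> powr - a * sin x powr (1 + a)) * indicator {0..pi} x"
    proof eventually_elim
      case (elim x)
      show ?case
      proof (cases "x \<in> {0..pi}")
        case True
        with elim have s: "sin x > 0" by (intro sin_gt_zero) auto
        hence "poly (cheb_U n) (cos x) = sin (real (n + 1) * x) / sin x"
          using is_cheb_U_cheb_U[of n] unfolding is_cheb_U_def by simp
        hence "u (- cos x) = (\<bar>sin (real (n + 1) * x)\<bar> / sin x) powr - a"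
          using s by (simp only: u_def abs_poly_cheb_U_minus) (simp add: a_def)
        also have "\<dots> = \<bar>sin (real (n + 1) * x)\<bar> powr - a / sin x powr - a"
          by (rule powr_divide)
        also have "\<dots> = \<bar>sin (real (n + 1) * x)\<bar> powr - a * sin x powr a"
          by (simp add: powr_minus divide_inverse)
        finally have u: "u (- cos x) = \<bar>sin (real (n + 1) * x)\<bar> powr - a * sin x powr a" .
        have "u (- cos x) * sin x = \<bar>sin (real (n + 1) * x)\<bar> powr - a * sin x powr (1 + a)"
          unfolding u using s by (simp add: powr_add)
        thus ?thesis using True by simp
      qed simp
    qed
  qed
  finally show ?thesis by (simp add: u_def a_def)
qed

text \<open>The g of the overview is \<open>s\<close> here, and the upper bound integrates (h - 1)
  (1 - s) \<ge> 0. The term \<open>pi\<close>, the integral of 1, stands on the left so that no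
  subtraction of extended reals occurs.\<close>

lemma nn_integral_cheb_U_inner_bounds:
  assumes n: "n \<ge> 3"
  defines "I \<equiv> (\<integral>\<^sup>+x. ennreal (\<bar>poly (cheb_U n) x\<bar> powr (- 2 / real n)) * indicator {-1..1} x \<partial>lborel)"
  shows "ennreal (Beta (1 + 1 / real n) (1 / 2)) \<le> I"
    "I + ennreal pi \<le> ennreal (Beta (1 / 2 - 1 / real n) (1 / 2)) + ennreal (Beta (1 + 1 / real n) (1 / 2))"
proof -
  define a where "a = 2 / real n"
  \<comment> \<open>The bound a < 1, a consequence of n \<ge> 3, is what makes the integral of
    \<open>h\<close> converge.\<close>
  have a: "0 < a" "a < 1" using n by (auto simp: a_def)
  define h where "h x = \<bar>sin (real (n + 1) * x)\<bar> powr - a" for x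
  define s where "s x = sin x powr (1 + a)" for x :: real
  have [measurable]: "h \<in> borel_measurable borel" "s \<in> borel_measurable borel"
    unfolding h_def s_def by measurable
  have I: "I = (\<integral>\<^sup>+x. ennreal (h x * s x) * indicator {0..pi} x \<partial>lborel)"
    unfolding I_def using nn_integral_cheb_U_inner[of n] by (simp add: h_def s_def a_def)
  have S: "(\<integral>\<^sup>+x. ennreal (s x) * indicator {0..pi} x \<partial>lborel) = ennreal (Beta (1 + 1 / real n) (1 / 2))"
  proof -
    have "(\<integral>\<^sup>+x. ennreal (s x) * indicator {0..pi} x \<partial>lborel) = ennreal (Beta ((1 + (1 + a)) / 2) (1 / 2))"
      unfolding s_def using a by (intro nn_integral_sin_powr) simp
    also have "(1 + (1 + a)) / 2 = 1 + 1 / real n" by (simp add: a_def add_divide_distrib)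
    finally show ?thesis .
  qed
  have H: "(\<integral>\<^sup>+x. ennreal (h x) * indicator {0..pi} x \<partial>lborel) = ennreal (Beta (1 / 2 - 1 / real n) (1 / 2))"
  proof -
    have "(\<integral>\<^sup>+x. ennreal (h x) * indicator {0..pi} x \<partial>lborel)
        = (\<integral>\<^sup>+x. ennreal (\<bar>sin x\<bar> powr - a) * indicator {0..pi} x \<partial>lborel)"
      unfolding h_def
      by (rule nn_integral_periodic_scale[of "\<lambda>x. ennreal (\<bar>sin x\<bar> powr - a)" pi "n + 1"]) auto
    also have "\<dots> = (\<integral>\<^sup>+x. ennreal (sin x powr - a) * indicator {0..pi} x \<partial>lborel)"
      by (intro nn_integral_cong) (auto simp: indicator_def sin_ge_zero)
    also have "\<dots> = ennreal (Beta ((1 + - a) / 2) (1 / 2))"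
      using a by (intro nn_integral_sin_powr) auto
    also have "(1 + - a) / 2 = 1 / 2 - 1 / real n" by (simp add: a_def diff_divide_distrib)
    finally show ?thesis .
  qed
  have s01: "0 \<le> s x" "s x \<le> 1" if "x \<in> {0..pi}" for x
    using that a sin_ge_zero[of x] by (auto simp: s_def intro!: powr_le1)
  \<comment> \<open>At these zeros \<open>0 powr - a\<close> is 0 by convention, so h \<ge> 1 fails;
    they form a countable set, hence a null set.\<close>
  have "AE x in lborel. x \<notin> {x. sin (real (n + 1) * x) = 0}"
  proof (intro AE_not_in countable_imp_null_set_lborel)
    have "{x. sin (real (n + 1) * x) = 0} \<subseteq> range (\<lambda>i::int. real_of_int i * pi / real (n + 1))"
      by (auto simp: sin_zero_iff_int2 field_simps)
    thus "countable {x. sin (real (n + 1) * x) = 0}"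
      by (rule countable_subset) auto
  qed
  hence h1: "AE x in lborel. h x \<ge> 1"
  proof eventually_elim
    case (elim x)
    thus ?case using powr_mono2'[of "- a" "\<bar>sin (real (n + 1) * x)\<bar>" 1] a by (simp add: h_def)
  qed
  show "ennreal (Beta (1 + 1 / real n) (1 / 2)) \<le> I"
    unfolding I S [symmetric]
  proof (rule nn_integral_mono_AE)
    show "AE x in lborel. ennreal (s x) * indicator {0..pi} x \<le> ennreal (h x * s x) * indicator {0..pi} x"
      using h1
    proof eventually_elim
      case (elim x)
      thus ?case using mult_right_mono[of 1 "h x" "s x"] s01(1)[of x]
        by (auto simp: indicator_def intro!: ennreal_leI)
    qed
  qed
  have "I + ennreal pi = (\<integral>\<^sup>+x. ennreal (h x * s x) * indicator {0..pi} x \<partial>lborel)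
      + (\<integral>\<^sup>+x. indicator {0..pi} x \<partial>lborel)"
    by (simp add: I)
  also have "\<dots> = (\<integral>\<^sup>+x. ennreal (h x * s x) * indicator {0..pi} x + indicator {0..pi} x \<partial>lborel)"
    by (rule nn_integral_add [symmetric]) measurable
  also have "\<dots> \<le> (\<integral>\<^sup>+x. ennreal (h x) * indicator {0..pi} x + ennreal (s x) * indicator {0..pi} x \<partial>lborel)"
  proof (rule nn_integral_mono_AE)
    show "AE x in lborel. ennreal (h x * s x) * indicator {0..pi} x + indicator {0..pi} x
      \<le> ennreal (h x) * indicator {0..pi} x + ennreal (s x) * indicator {0..pi} x"
      using h1
    proof eventually_elim
      case (elim x)
      show ?case
      proof (cases "x \<in> {0..pi}")
        case True
        have "(h x - 1) * (1 - s x) \<ge> 0" using elim s01[OF True] by simp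
        hence "h x * s x + 1 \<le> h x + s x" by (simp add: algebra_simps)
        hence "ennreal (h x * s x + 1) \<le> ennreal (h x + s x)" by (rule ennreal_leI)
        moreover have "h x * s x \<ge> 0" using elim s01[OF True] by simp
        ultimately show ?thesis using True elim s01[OF True]
          by (simp add: ennreal_plus)
      qed simp
    qed
  qed
  also have "\<dots> = ennreal (Beta (1 / 2 - 1 / real n) (1 / 2)) + ennreal (Beta (1 + 1 / real n) (1 / 2))"
    by (subst nn_integral_add) (auto simp: H S)
  finally show "I + ennreal pi \<le> ennreal (Beta (1 / 2 - 1 / real n) (1 / 2)) + ennreal (Beta (1 + 1 / real n) (1 / 2))" .
qed

section \<open>Assembling the area bounds\<close>

lemma Beta_real_nonneg:
  fixes a b :: real
  assumes "a > 0" "b > 0"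
  shows "Beta a b \<ge> 0"
  using assms by (simp add: Beta_def Gamma_real_pos less_imp_le)

text \<open>The line is cut at -1 and 1, and by parity the area is I + 2 J with \<open>I\<close> the
  bounded piece and \<open>J\<close> the integral over x > 1.\<close>

lemma cheb_U_form_area_bounds:
  assumes n: "n \<ge> 3"
  shows "form_area (cheb_U_form n) > Beta (1 + 1 / real n) (1 / 2) + 2 / 3 * real (n + 1) powr (- 2 / real n)"
    "form_area (cheb_U_form n) < Beta (1 + 1 / real n) (1 / 2) + Beta (1 / 2 - 1 / real n) (1 / 2) - pi + 2 / 3"
proof -
  define u where "u x = ennreal (\<bar>poly (cheb_U n) x\<bar> powr (- 2 / real n))" for x
  have "poly (cheb_U n) \<in> borel_measurable borel"
    by (intro borel_measurable_continuous_onI continuous_intros)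
  hence [measurable]: "u \<in> borel_measurable borel" unfolding u_def by measurable
  define J where "J = (\<integral>\<^sup>+x. u x * indicator {1<..} x \<partial>lborel)"
  define I where "I = (\<integral>\<^sup>+x. u x * indicator {-1..1} x \<partial>lborel)"
  have Jneg: "(\<integral>\<^sup>+x. u x * indicator {..<-1} x \<partial>lborel) = J"
  proof -
    have "(\<integral>\<^sup>+x. u x * indicator {..<-1} x \<partial>lborel)
        = ennreal \<bar>-1\<bar> * (\<integral>\<^sup>+x. u (0 + (- 1) * x) * indicator {..<-1} (0 + (- 1) * x) \<partial>lborel)"
      by (rule nn_integral_real_affine) auto
    also have "\<dots> = J"
      by (auto simp: J_def u_def abs_poly_cheb_U_minus indicator_def intro!: nn_integral_cong)
    finally show ?thesis .
  qed
  have area: "emeasure lborel {(x, y). \<bar>cheb_U_form n x y\<bar> \<le> 1} = J + I + J"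
  proof -
    have "emeasure lborel {(x, y). \<bar>cheb_U_form n x y\<bar> \<le> 1} = (\<integral>\<^sup>+x. u x \<partial>lborel)"
      unfolding cheb_U_form_def u_def using n
      by (intro emeasure_homogenization degree_cheb_U_le cheb_U_nonzero) auto
    also have "\<dots> = (\<integral>\<^sup>+x. (u x * indicator {..<-1} x + u x * indicator {-1..1} x) + u x * indicator {1<..} x \<partial>lborel)"
      by (intro nn_integral_cong) (auto simp: indicator_def)
    also have "\<dots> = (\<integral>\<^sup>+x. u x * indicator {..<-1} x \<partial>lborel) + I + J"
      by (simp add: nn_integral_add I_def J_def)
    finally show ?thesis by (simp only: Jneg)
  qed
  have Jb: "J < ennreal (1 / 3)" "ennreal (real (n + 1) powr (- 2 / real n) / 3) < J"
    using nn_integral_cheb_U_outer[of n] n by (auto simp: J_def u_def)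
  have Ib: "ennreal (Beta (1 + 1 / real n) (1 / 2)) \<le> I"
    "I + ennreal pi \<le> ennreal (Beta (1 / 2 - 1 / real n) (1 / 2)) + ennreal (Beta (1 + 1 / real n) (1 / 2))"
    using nn_integral_cheb_U_inner_bounds[of n] n by (auto simp: I_def u_def)
  \<comment> \<open>Finiteness has to be settled before passing to real numbers, because
    \<open>measure\<close> assigns 0 to a set of infinite area.\<close>
  have "J < top" using Jb(1) by (rule less_trans) simp
  then obtain j where j: "J = ennreal j" "j \<ge> 0" by (cases J) auto
  have "I \<le> I + ennreal pi" by simp
  also have "\<dots> < top" using Ib(2) by (rule le_less_trans) simp
  finally obtain i where i: "I = ennreal i" "i \<ge> 0" by (cases I) auto
  \<comment> \<open>Since \<open>ennreal\<close> truncates negative numbers to 0, the bounds can be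
    read back in the reals only for nonnegative beta values.\<close>
  have B: "Beta (1 / 2 - 1 / real n) (1 / 2) \<ge> 0" "Beta (1 + 1 / real n) (1 / 2) \<ge> 0"
    using n by (auto intro!: Beta_real_nonneg add_pos_nonneg simp: field_simps)
  have jb: "j < 1 / 3" "real (n + 1) powr (- 2 / real n) / 3 < j"
    using Jb j by (simp_all add: ennreal_less_iff)
  have ib: "Beta (1 + 1 / real n) (1 / 2) \<le> i"
    "i + pi \<le> Beta (1 / 2 - 1 / real n) (1 / 2) + Beta (1 + 1 / real n) (1 / 2)"
    using Ib i B by (simp_all add: ennreal_le_iff flip: ennreal_plus)
  have A: "form_area (cheb_U_form n) = j + i + j"
    using area i j by (simp add: form_area_def measure_def flip: ennreal_plus)
  show "form_area (cheb_U_form n) > Beta (1 + 1 / real n) (1 / 2) + 2 / 3 * real (n + 1) powr (- 2 / real n)"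
    "form_area (cheb_U_form n) < Beta (1 + 1 / real n) (1 / 2) + Beta (1 / 2 - 1 / real n) (1 / 2) - pi + 2 / 3"
    using jb ib unfolding A by linarith+
qed

section \<open>The limit of the areas\<close>

lemma Beta_one_half: "Beta 1 (1 / 2 :: real) = 2"
proof -
  have gamma: "Gamma (3 / 2 :: real) = 1 / 2 * Gamma (1 / 2)"
    using Gamma_plus1[of "1 / 2 :: real"] nonpos_Ints_nonpos[of "1 / 2 :: real"] by auto
  have "Beta 1 (1 / 2 :: real) = Gamma (1 / 2) / Gamma (3 / 2)" by (simp add: Beta_def)
  also have "\<dots> = 2" unfolding gamma by (simp add: Gamma_one_half_real)
  finally show ?thesis .
qed

lemma Beta_half_half: "Beta (1 / 2) (1 / 2 :: real) = pi"
  by (simp add: Beta_def Gamma_one_half_real)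

text \<open>Gamma is continuous off its poles at the nonpositive integers, and positivity of
  \<open>a\<close> and \<open>b\<close> keeps all arguments in the limit away from them.\<close>

lemma tendsto_Beta_left:
  fixes a b :: real
  assumes "(f \<longlongrightarrow> a) F" "a > 0" "b > 0"
  shows "((\<lambda>x. Beta (f x) b) \<longlongrightarrow> Beta a b) F"
proof -
  have "Gamma (a + b) > 0" using assms by (intro Gamma_real_pos) simp
  hence "Gamma (a + b) \<noteq> 0" by simp
  moreover have "a \<notin> \<int>\<^sub>\<le>\<^sub>0" "a + b \<notin> \<int>\<^sub>\<le>\<^sub>0"
    using assms by (auto dest: nonpos_Ints_nonpos)
  ultimately show ?thesis
    unfolding Beta_def by (intro tendsto_intros assms(1))
qed

theorem theorem3:
  shows "(\<forall>n::nat. n \<ge> 3 \<longrightarrow>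
            form_area (cheb_U_form n) >
              8 / 3 + (Beta (1 + 1 / real n) (1 / 2) - 2)
                + 2 / 3 * (real (n + 1) powr (- 2 / real n) - 1) \<and>
            form_area (cheb_U_form n) <
              8 / 3 + (Beta (1 + 1 / real n) (1 / 2) - 2)
                + Beta (1 / 2 - 1 / real n) (1 / 2) - pi) \<and>
         (\<lambda>n. form_area (cheb_U_form n)) \<longlonglongrightarrow> 8 / 3"
proof
  show bounds: "\<forall>n::nat. n \<ge> 3 \<longrightarrow>
            form_area (cheb_U_form n) >
              8 / 3 + (Beta (1 + 1 / real n) (1 / 2) - 2)
                + 2 / 3 * (real (n + 1) powr (- 2 / real n) - 1) \<and>
            form_area (cheb_U_form n) <
              8 / 3 + (Beta (1 + 1 / real n) (1 / 2) - 2)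
                + Beta (1 / 2 - 1 / real n) (1 / 2) - pi"
    \<comment> \<open>Only a regrouping: 8/3 - 2 = 2/3 is the upper bound for the two unbounded
      pieces.\<close>
    using cheb_U_form_area_bounds by (auto simp: algebra_simps)
  have B1: "(\<lambda>n. Beta (1 + 1 / real n) (1 / 2)) \<longlonglongrightarrow> 2"
  proof -
    have "(\<lambda>n. 1 + 1 / real n) \<longlonglongrightarrow> 1" by real_asymp
    from tendsto_Beta_left[OF this, of "1 / 2"] show ?thesis by (simp add: Beta_one_half)
  qed
  have B2: "(\<lambda>n. Beta (1 / 2 - 1 / real n) (1 / 2)) \<longlonglongrightarrow> pi"
  proof -
    have "(\<lambda>n. 1 / 2 - 1 / real n) \<longlonglongrightarrow> 1 / 2" by real_asymp
    from tendsto_Beta_left[OF this, of "1 / 2"] show ?thesis by (simp add: Beta_half_half)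
  qed
  have P: "(\<lambda>n. real (n + 1) powr (- 2 / real n)) \<longlonglongrightarrow> 1" by real_asymp
  have lower_lim: "(\<lambda>n. 8 / 3 + (Beta (1 + 1 / real n) (1 / 2) - 2)
      + 2 / 3 * (real (n + 1) powr (- 2 / real n) - 1)) \<longlonglongrightarrow> 8 / 3 + (2 - 2) + 2 / 3 * (1 - 1)"
    by (intro tendsto_add tendsto_diff tendsto_mult tendsto_const B1 P)
  have upper_lim: "(\<lambda>n. 8 / 3 + (Beta (1 + 1 / real n) (1 / 2) - 2)
      + Beta (1 / 2 - 1 / real n) (1 / 2) - pi) \<longlonglongrightarrow> 8 / 3 + (2 - 2) + pi - pi"
    by (intro tendsto_add tendsto_diff tendsto_const B1 B2)
  show "(\<lambda>n. form_area (cheb_U_form n)) \<longlonglongrightarrow> 8 / 3"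
  proof (rule tendsto_sandwich)
    show "\<forall>\<^sub>F n in sequentially. 8 / 3 + (Beta (1 + 1 / real n) (1 / 2) - 2)
                + 2 / 3 * (real (n + 1) powr (- 2 / real n) - 1) \<le> form_area (cheb_U_form n)"
      using eventually_ge_at_top[of 3] by eventually_elim (use bounds in \<open>auto intro: less_imp_le\<close>)
    show "\<forall>\<^sub>F n in sequentially. form_area (cheb_U_form n) \<le> 8 / 3 + (Beta (1 + 1 / real n) (1 / 2) - 2)
                + Beta (1 / 2 - 1 / real n) (1 / 2) - pi"
      using eventually_ge_at_top[of 3] by eventually_elim (use bounds in \<open>auto intro: less_imp_le\<close>)
    show "(\<lambda>n. 8 / 3 + (Beta (1 + 1 / real n) (1 / 2) - 2)
                + 2 / 3 * (real (n + 1) powr (- 2 / real n) - 1)) \<longlonglongrightarrow> 8 / 3"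
      using lower_lim by simp
    show "(\<lambda>n. 8 / 3 + (Beta (1 + 1 / real n) (1 / 2) - 2)
                + Beta (1 / 2 - 1 / real n) (1 / 2) - pi) \<longlonglongrightarrow> 8 / 3"
      using upper_lim by simp
  qed
qed

end
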